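(* Let $S$ be a commutative ring, let $R$ be an associative unital (not necessarily commutative) $S$-algebra, let $\alpha:R\to R$ be an $S$-linear unital ring endomorphism, and choose $t\in S$ such that $(t)_{\underline{n}}$ is a unit in $S$ for all $n$. For maps $f,g:\mathbb{N}\to R$ define $$(f\boxplus^{H,\alpha}_{t}g)(n)=\sum_{i+j=n}\frac{(t)_{\underline{n}}}{(t)_{\underline{i}}(t)_{\underline{j}}}\,f(i)\,\alpha^i(g(j)),\qquad n\in\mathbb{N}.$$ Then $\boxplus^{H,\alpha}_{t}$ is associative and has (two-sided) identity $h_1$. Its specialization at $t=-1$ is the multiplication of the skew Hurwitz series ring $(HR,\alpha)$, i.e. $(f\boxplus^{H,\alpha}_{-1}g)(n)=\sum_{k=0}^n\binom nk f(k)\alpha^k(g(n-k))$ for all $n$.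
   Context: $\mathbb{N}=\{0,1,2,\dots\}$. For $a\in S$: $(a)_{\underline{0}}=1$ and $(a)_{\underline{n}}=a(a-1)\cdots(a-n+1)$ for $n\ge1$. The skew Hurwitz series ring $(HR,\alpha)$ is the set of all maps $f:\mathbb{N}\to R$ with componentwise addition and multiplication $(fg)(n)=\sum_{k=0}^n\binom nk f(k)\alpha^k(g(n-k))$. The element $h_1$ is given by $h_1(0)=1$, $h_1(m)=0$ for $m\neq0$. In the last assertion, $t=-1$ is understood to be an allowed value, i.e. $(-1)_{\underline{n}}=(-1)^n n!$ is a unit in $S$ for all $n$. *)

theory Defs
  imports "HOL-Algebra.Module"
begin

(* The library locale algebra requires the algebra itself to be commutative; this one does not. *)
locale assoc_algebra = module S R + ring R for S (structure) and R (structure) +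
  assumes smult_mult_left:
    "\<lbrakk>a \<in> carrier S; x \<in> carrier R; y \<in> carrier R\<rbrakk> \<Longrightarrow>
       (a \<odot>\<^bsub>R\<^esub> x) \<otimes>\<^bsub>R\<^esub> y = a \<odot>\<^bsub>R\<^esub> (x \<otimes>\<^bsub>R\<^esub> y)"
  and smult_mult_right:
    "\<lbrakk>a \<in> carrier S; x \<in> carrier R; y \<in> carrier R\<rbrakk> \<Longrightarrow>
       x \<otimes>\<^bsub>R\<^esub> (a \<odot>\<^bsub>R\<^esub> y) = a \<odot>\<^bsub>R\<^esub> (x \<otimes>\<^bsub>R\<^esub> y)"

definition algebra_endomorphism ::
    "('s, 'm) ring_scheme \<Rightarrow> ('s, 'r, 'k) module_scheme \<Rightarrow> ('r \<Rightarrow> 'r) \<Rightarrow> bool" where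
  "algebra_endomorphism S R \<alpha> \<longleftrightarrow>
     \<alpha> \<in> ring_hom R R \<and>
     (\<forall>a\<in>carrier S. \<forall>x\<in>carrier R. \<alpha> (a \<odot>\<^bsub>R\<^esub> x) = a \<odot>\<^bsub>R\<^esub> \<alpha> x)"

definition falling :: "('s, 'm) ring_scheme \<Rightarrow> 's \<Rightarrow> nat \<Rightarrow> 's" where
  "falling S a n = (\<Otimes>\<^bsub>S\<^esub>k\<in>{..<n}. a \<ominus>\<^bsub>S\<^esub> [k] \<cdot>\<^bsub>S\<^esub> \<one>\<^bsub>S\<^esub>)"

(* Maps from the naturals to the carrier of R are elements of UNIV \<rightarrow> carrier R. *)
definition hurwitz_box ::
    "('s, 'm) ring_scheme \<Rightarrow> ('s, 'r, 'k) module_scheme \<Rightarrow> ('r \<Rightarrow> 'r) \<Rightarrow> 's \<Rightarrow>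
     (nat \<Rightarrow> 'r) \<Rightarrow> (nat \<Rightarrow> 'r) \<Rightarrow> nat \<Rightarrow> 'r" where
  "hurwitz_box S R \<alpha> t f g n =
     finsum R
       (\<lambda>(i, j). (falling S t n \<otimes>\<^bsub>S\<^esub> inv\<^bsub>S\<^esub> (falling S t i \<otimes>\<^bsub>S\<^esub> falling S t j))
                    \<odot>\<^bsub>R\<^esub> (f i \<otimes>\<^bsub>R\<^esub> (\<alpha> ^^ i) (g j)))
       {(i, j). i + j = n}"

definition h1 :: "('r, 'k) ring_scheme \<Rightarrow> nat \<Rightarrow> 'r" where
  "h1 R = (\<lambda>m. if m = 0 then \<one>\<^bsub>R\<^esub> else \<zero>\<^bsub>R\<^esub>)"

definition skew_hurwitz_ring ::
    "('r, 'k) ring_scheme \<Rightarrow> ('r \<Rightarrow> 'r) \<Rightarrow> (nat \<Rightarrow> 'r) ring" where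
  "skew_hurwitz_ring R \<alpha> =
     \<lparr>carrier = UNIV \<rightarrow> carrier R,
      mult = (\<lambda>f g n. \<Oplus>\<^bsub>R\<^esub>k\<in>{..n}. [(n choose k)] \<cdot>\<^bsub>R\<^esub> (f k \<otimes>\<^bsub>R\<^esub> (\<alpha> ^^ k) (g (n - k)))),
      one = h1 R,
      zero = (\<lambda>n. \<zero>\<^bsub>R\<^esub>),
      add = (\<lambda>f g n. f n \<oplus>\<^bsub>R\<^esub> g n)\<rparr>"

end

theory Submission
  imports Defs
begin

text \<open>
  Write \<open>c i j = (t)\<^sub>i\<^sub>+\<^sub>j / ((t)\<^sub>i (t)\<^sub>j)\<close>. Associativity rests on the cocycle identity
  \<open>c (i + j) k \<cdot> c i j = c i (j + k) \<cdot> c j k\<close>, both sides being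
  \<open>(t)\<^sub>i\<^sub>+\<^sub>j\<^sub>+\<^sub>k / ((t)\<^sub>i (t)\<^sub>j (t)\<^sub>k)\<close>. For \<open>t = -1\<close> one has \<open>(t)\<^sub>n = (-1)\<^sup>n n!\<close>, so
  \<open>c i j\<close> is the binomial coefficient.
\<close>

section \<open>The coefficients and their cocycle identity\<close>

definition hurwitz_coeff :: "('s, 'm) ring_scheme \<Rightarrow> 's \<Rightarrow> nat \<Rightarrow> nat \<Rightarrow> 's" where
  "hurwitz_coeff S t i j =
     falling S t (i + j) \<otimes>\<^bsub>S\<^esub> inv\<^bsub>S\<^esub> (falling S t i \<otimes>\<^bsub>S\<^esub> falling S t j)"

lemma (in comm_monoid) inv_mult_Units:
  assumes "x \<in> Units G" "y \<in> Units G"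
  shows "inv (x \<otimes> y) = inv x \<otimes> inv y"
proof (rule comm_inv_char)
  have "x \<otimes> y \<otimes> (inv x \<otimes> inv y) = (x \<otimes> inv x) \<otimes> (y \<otimes> inv y)"
    using assms by (simp add: m_ac Units_closed del: Units_r_inv)
  then show "x \<otimes> y \<otimes> (inv x \<otimes> inv y) = \<one>"
    using assms by simp
qed (use assms in \<open>auto simp: Units_closed\<close>)

lemma (in cring) hurwitz_coeff_closed:
  assumes "\<And>n. falling R t n \<in> Units R"
  shows "hurwitz_coeff R t i j \<in> carrier R"
  using assms by (simp add: hurwitz_coeff_def Units_closed)

lemma (in cring) hurwitz_coeff_cocycle:
  assumes u: "\<And>n. falling R t n \<in> Units R"
  shows "hurwitz_coeff R t (i + j) k \<otimes> hurwitz_coeff R t i j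
       = hurwitz_coeff R t i (j + k) \<otimes> hurwitz_coeff R t j k"
proof -
  \<comment> \<open>\<open>b\<close> is the falling factorial at the intermediate sum,
    \<open>i + j\<close> or \<open>j + k\<close>: it is the numerator of one coefficient and lies in
    the denominator of the other.\<close>
  have cancel: "(a \<otimes> (inv b \<otimes> x)) \<otimes> (b \<otimes> y) = a \<otimes> (x \<otimes> y)"
    if "a \<in> carrier R" "b \<in> Units R" "x \<in> carrier R" "y \<in> carrier R" for a b x y
  proof -
    have "(a \<otimes> (inv b \<otimes> x)) \<otimes> (b \<otimes> y) = (b \<otimes> inv b) \<otimes> (a \<otimes> (x \<otimes> y))"
      using that by (simp add: m_ac Units_closed del: Units_r_inv)
    then show ?thesis
      using that by simp
  qed
  have c: "falling R t n \<in> carrier R" for n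
    using u by blast
  have "hurwitz_coeff R t (i + j) k \<otimes> hurwitz_coeff R t i j
      = falling R t (i + j + k) \<otimes>
          (inv (falling R t k) \<otimes> (inv (falling R t i) \<otimes> inv (falling R t j)))"
    using u c by (simp add: hurwitz_coeff_def inv_mult_Units cancel)
  moreover have "hurwitz_coeff R t i (j + k) \<otimes> hurwitz_coeff R t j k
      = falling R t (i + j + k) \<otimes>
          (inv (falling R t i) \<otimes> (inv (falling R t j) \<otimes> inv (falling R t k)))"
    \<comment> \<open>The factor to be cancelled, at \<open>j + k\<close>, comes second in this
      denominator; the swap puts it first, where \<open>cancel\<close> expects it.\<close>
    using u c m_comm[of "inv (falling R t i)" "inv (falling R t (j + k))"]
    by (simp add: hurwitz_coeff_def inv_mult_Units cancel add.assoc)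
  ultimately show ?thesis
    using u by (simp add: m_ac)
qed

section \<open>Normalisation and the value at -1\<close>

lemma (in cring) falling_0: "falling R t 0 = \<one>"
  by (simp add: falling_def)

lemma (in cring) falling_Suc:
  assumes "t \<in> carrier R"
  shows "falling R t (Suc n) = falling R t n \<otimes> (t \<ominus> [n] \<cdot> \<one>)"
  using assms by (simp add: falling_def lessThan_Suc Pi_def m_comm)

text \<open>The empty product is 1, so the quotient is \<open>(t)\<^sub>n / (t)\<^sub>n\<close>.
  This normalisation of the cocycle is what makes \<open>h1\<close> neutral.\<close>

lemma (in cring) hurwitz_coeff_0:
  assumes "\<And>n. falling R t n \<in> Units R"
  shows "hurwitz_coeff R t 0 n = \<one>" "hurwitz_coeff R t n 0 = \<one>"
  using assms by (simp_all add: hurwitz_coeff_def falling_0 Units_closed)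

text \<open>Transports identities between natural numbers, here those of factorials, to multiples of
  1.\<close>

lemma (in ring) add_pow_mult_one:
  "([(m::nat)] \<cdot> \<one>) \<otimes> ([n] \<cdot> \<one>) = [(m * n)] \<cdot> \<one>"
  by (simp add: add_pow_ldistr add.nat_pow_pow mult.commute)

text \<open>Each factor is -1 - k = -(k + 1), contributing one sign and one factor of the
  factorial.\<close>

lemma (in cring) falling_minus_one:
  "falling R (\<ominus> \<one>) n = (\<ominus> \<one>) [^] n \<otimes> [(fact n :: nat)] \<cdot> \<one>"
proof (induction n)
  case 0
  then show ?case by (simp add: falling_0)
next
  case (Suc n)
  have "\<ominus> \<one> \<ominus> [n] \<cdot> \<one> = \<ominus> \<one> \<otimes> [(Suc n)] \<cdot> \<one>"
    by (simp add: a_minus_def minus_add l_minus a_comm)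
  then have "falling R (\<ominus> \<one>) (Suc n)
      = ((\<ominus> \<one>) [^] n \<otimes> [(fact n :: nat)] \<cdot> \<one>) \<otimes> (\<ominus> \<one> \<otimes> [(Suc n)] \<cdot> \<one>)"
    by (simp only: falling_Suc[OF a_inv_closed[OF one_closed]] Suc.IH)
  also have "\<dots> = ((\<ominus> \<one>) [^] n \<otimes> \<ominus> \<one>) \<otimes> ([(fact n :: nat)] \<cdot> \<one> \<otimes> [(Suc n)] \<cdot> \<one>)"
    by (intro m_assoc[THEN trans]) (simp_all add: m_ac del: add.nat_pow_Suc)
  also have "\<dots> = (\<ominus> \<one>) [^] Suc n \<otimes> [(fact (Suc n) :: nat)] \<cdot> \<one>"
    by (simp only: add_pow_mult_one nat_pow_Suc fact_Suc mult.commute of_nat_id)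
  finally show ?case .
qed

text \<open>The signs multiply up correctly and \<open>(i + j)!\<close> is the binomial coefficient
  times \<open>i! j!\<close>. The numerator is first written as a multiple of the denominator, so
  the only inverse involved is that of the whole denominator.\<close>

lemma (in cring) hurwitz_coeff_minus_one:
  assumes u: "\<And>n. falling R (\<ominus> \<one>) n \<in> Units R"
  shows "hurwitz_coeff R (\<ominus> \<one>) i j = [((i + j) choose i)] \<cdot> \<one>"
proof -
  \<comment> \<open>Opaque names keep the powers and multiples intact while the factors are
    permuted.\<close>
  define p q :: "nat \<Rightarrow> 'a" where "p n = (\<ominus> \<one>) [^] n" and "q n = [n] \<cdot> \<one>" for n
  have pq: "p n \<in> carrier R" "q n \<in> carrier R" for n
    by (simp_all add: p_def q_def)
  have "fact (i + j) = ((i + j) choose i) * (fact i * fact j :: nat)"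
    using binomial_fact_lemma[of i "i + j"] by (simp add: ac_simps)
  then have "q (fact (i + j)) = q ((i + j) choose i) \<otimes> (q (fact i) \<otimes> q (fact j))"
    by (simp add: q_def add_pow_mult_one)
  moreover have "p (i + j) = p i \<otimes> p j"
    by (simp add: p_def nat_pow_mult)
  ultimately have "falling R (\<ominus> \<one>) (i + j)
      = q ((i + j) choose i) \<otimes> (falling R (\<ominus> \<one>) i \<otimes> falling R (\<ominus> \<one>) j)"
    using pq by (simp add: falling_minus_one m_ac flip: p_def q_def)
  then show ?thesis
    using pq Units_closed[OF Units_m_closed[OF u u]] Units_inv_closed[OF Units_m_closed[OF u u]]
      Units_r_inv[OF Units_m_closed[OF u u]]
    by (simp only: hurwitz_coeff_def m_assoc r_one q_def)
qed

section \<open>Reordering a sum over a triangle\<close>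

lemma (in abelian_monoid) finsum_triangle:
  assumes F: "\<And>i j. F i j \<in> carrier G"
  shows "(\<Oplus>k\<in>{..n::nat}. \<Oplus>i\<in>{..k}. F i (k - i)) = (\<Oplus>i\<in>{..n}. \<Oplus>j\<in>{..n - i}. F i j)"
\<comment> \<open>Both sides run over the pairs with \<open>i + j \<le> n\<close>, by diagonals on
  the left and by rows on the right.\<close>
proof (induction n)
  case 0
  then show ?case using F by simp
next
  case (Suc n)
  \<comment> \<open>Every old row gains one entry and the new row is \<open>F (Suc n) 0\<close>
    alone; the new entries together form the diagonal \<open>i + j = Suc n\<close>.\<close>
  have "(\<Oplus>i\<in>{..Suc n}. \<Oplus>j\<in>{..Suc n - i}. F i j)
      = F (Suc n) 0 \<oplus> (\<Oplus>i\<in>{..n}. F i (Suc n - i) \<oplus> (\<Oplus>j\<in>{..n - i}. F i j))"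
    using F by (simp add: Suc_diff_le Pi_def cong: finsum_cong)
  also have "\<dots> = (\<Oplus>i\<in>{..Suc n}. F i (Suc n - i)) \<oplus> (\<Oplus>i\<in>{..n}. \<Oplus>j\<in>{..n - i}. F i j)"
    using F by (simp add: finsum_addf Pi_def a_assoc)
  also have "\<dots> = (\<Oplus>k\<in>{..Suc n}. \<Oplus>i\<in>{..k}. F i (k - i))"
    using F by (simp add: Suc.IH[symmetric] Pi_def del: diff_Suc_Suc)
  finally show ?case by simp
qed

section \<open>Endomorphisms and scalars of the algebra\<close>

context assoc_algebra
begin

lemma algebra_endomorphism_funpow:
  assumes "algebra_endomorphism S R \<alpha>"
  shows "algebra_endomorphism S R (\<alpha> ^^ n)"
proof (induction n)
  case 0
  then show ?case
    by (auto simp: algebra_endomorphism_def ring_hom_def)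
next
  case (Suc n)
  with assms show ?case
    by (auto simp: algebra_endomorphism_def ring_hom_def Pi_def)
qed

lemma algebra_endomorphism_funpow_closed:
  assumes "algebra_endomorphism S R \<alpha>" "x \<in> carrier R"
  shows "(\<alpha> ^^ n) x \<in> carrier R"
  using algebra_endomorphism_funpow[OF assms(1), of n] assms(2)
  by (auto simp: algebra_endomorphism_def intro: ring_hom_closed)

lemma algebra_endomorphism_finsum:
  assumes "algebra_endomorphism S R \<beta>" and "finite A" and "f \<in> A \<rightarrow> carrier R"
  shows "\<beta> (\<Oplus>\<^bsub>R\<^esub>i\<in>A. f i) = (\<Oplus>\<^bsub>R\<^esub>i\<in>A. \<beta> (f i))"
proof -
  have hom: "\<beta> \<in> ring_hom R R"
    using assms by (simp add: algebra_endomorphism_def)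
  show ?thesis
    using assms(2,3)
  proof (induction A)
    case empty
    then show ?case
      by (simp add: ring_hom_zero[OF hom ring_axioms ring_axioms])
  next
    case (insert x A)
    then show ?case
      by (simp add: Pi_def ring_hom_add[OF hom] ring_hom_closed[OF hom])
  qed
qed

text \<open>Links a binomial coefficient seen as a scalar from \<open>S\<close> with the multiple in
  \<open>R\<close> that occurs in \<open>skew_hurwitz_ring\<close>.\<close>

lemma add_pow_smult_one:
  assumes "x \<in> carrier R"
  shows "([(n::nat)] \<cdot>\<^bsub>S\<^esub> \<one>\<^bsub>S\<^esub>) \<odot>\<^bsub>R\<^esub> x = [n] \<cdot>\<^bsub>R\<^esub> x"
  using assms by (induction n) (simp_all add: smult_l_distr)

section \<open>The product of maps and its laws\<close>

lemma hurwitz_box_eq: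
  assumes "algebra_endomorphism S R \<alpha>" and u: "\<And>n. falling S t n \<in> Units S"
    and "f \<in> UNIV \<rightarrow> carrier R" "g \<in> UNIV \<rightarrow> carrier R"
  shows "hurwitz_box S R \<alpha> t f g n
       = (\<Oplus>\<^bsub>R\<^esub>k\<in>{..n}. hurwitz_coeff S t k (n - k) \<odot>\<^bsub>R\<^esub> (f k \<otimes>\<^bsub>R\<^esub> (\<alpha> ^^ k) (g (n - k))))"
proof -
  note \<alpha> = algebra_endomorphism_funpow_closed[OF assms(1)]
  \<comment> \<open>A pair with sum \<open>n\<close> is determined by its first entry, which gives a
    sum over one index.\<close>
  have img: "{(i, j). i + j = n} = (\<lambda>k. (k, n - k)) ` {..n}"
    by (auto simp: image_iff)
  show ?thesis
    \<comment> \<open>The qualifier in \<open>R.Units_closed\<close> is that of the base ring in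
      \<open>module\<close>, so the fact concerns \<open>S\<close>.\<close>
    unfolding hurwitz_box_def img
    by (subst finsum_reindex)
      (use assms in \<open>auto simp: inj_on_def hurwitz_coeff_def Pi_def R.Units_closed \<alpha>
         intro!: finsum_cong' smult_closed\<close>)
qed

lemma hurwitz_box_closed:
  assumes "algebra_endomorphism S R \<alpha>" and u: "\<And>n. falling S t n \<in> Units S"
    and "f \<in> UNIV \<rightarrow> carrier R" "g \<in> UNIV \<rightarrow> carrier R"
  shows "hurwitz_box S R \<alpha> t f g n \<in> carrier R"
proof -
  have "(\<alpha> ^^ i) (g j) \<in> carrier R" for i j
    using assms(4) by (auto intro: algebra_endomorphism_funpow_closed[OF assms(1)])
  then show ?thesis
    using assms(3) R.hurwitz_coeff_closed[OF u]
    unfolding hurwitz_box_eq[OF assms] by (simp add: Pi_def)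
qed

text \<open>Both bracketings expand to one sum over triples of total \<open>n\<close>: the left one
  groups them by the sum of the first two indices, the right one by the first index.\<close>

lemma hurwitz_box_assoc:
  assumes \<alpha>: "algebra_endomorphism S R \<alpha>" and u: "\<And>n. falling S t n \<in> Units S"
    and f: "f \<in> UNIV \<rightarrow> carrier R" and g: "g \<in> UNIV \<rightarrow> carrier R"
    and h: "h \<in> UNIV \<rightarrow> carrier R"
  shows "hurwitz_box S R \<alpha> t (hurwitz_box S R \<alpha> t f g) h
       = hurwitz_box S R \<alpha> t f (hurwitz_box S R \<alpha> t g h)"
proof
  fix n
  let ?c = "hurwitz_coeff S t"
  note box_eq = hurwitz_box_eq[OF \<alpha> u]
  note endo = algebra_endomorphism_funpow[OF \<alpha>]
  have c [simp]: "?c i j \<in> carrier S" for i j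
    by (rule R.hurwitz_coeff_closed[OF u])
  have fgh [simp]: "f i \<in> carrier R" "g i \<in> carrier R" "h i \<in> carrier R" for i
    using f g h by auto
  have hom: "\<alpha> ^^ i \<in> ring_hom R R" for i
    using endo by (simp add: algebra_endomorphism_def)
  note [simp] = algebra_endomorphism_funpow_closed[OF \<alpha>]
  \<comment> \<open>The summand of the triple \<open>(i, j, n - i - j)\<close>, with its scalars as
    the right bracketing produces them; only the left one then needs the cocycle identity.\<close>
  define F where "F n i j = (?c i (n - i) \<otimes>\<^bsub>S\<^esub> ?c j (n - i - j)) \<odot>\<^bsub>R\<^esub>
      (f i \<otimes>\<^bsub>R\<^esub> ((\<alpha> ^^ i) (g j) \<otimes>\<^bsub>R\<^esub> (\<alpha> ^^ (i + j)) (h (n - i - j))))" for n i j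
  have F [simp]: "F n i j \<in> carrier R" for i j
    by (simp add: F_def)
  have "?c k (n - k) \<odot>\<^bsub>R\<^esub> (hurwitz_box S R \<alpha> t f g k \<otimes>\<^bsub>R\<^esub> (\<alpha> ^^ k) (h (n - k)))
      = (\<Oplus>\<^bsub>R\<^esub>i\<in>{..k}. F n i (k - i))" if "k \<le> n" for k
  proof -
    have "F n i (k - i) = ?c k (n - k) \<odot>\<^bsub>R\<^esub>
        ((?c i (k - i) \<odot>\<^bsub>R\<^esub> (f i \<otimes>\<^bsub>R\<^esub> (\<alpha> ^^ i) (g (k - i)))) \<otimes>\<^bsub>R\<^esub> (\<alpha> ^^ k) (h (n - k)))"
      if "i \<le> k" for i
    proof -
      \<comment> \<open>The cocycle identity for the triple \<open>(i, k - i, n - k)\<close>; as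
        \<open>i \<le> k \<le> n\<close>, no subtraction is truncated.\<close>
      have "?c i (n - i) \<otimes>\<^bsub>S\<^esub> ?c (k - i) (n - k) = ?c k (n - k) \<otimes>\<^bsub>S\<^esub> ?c i (k - i)"
        using R.hurwitz_coeff_cocycle[OF u, of i "k - i" "n - k"] \<open>i \<le> k\<close> \<open>k \<le> n\<close> by simp
      then show ?thesis
        using \<open>i \<le> k\<close> \<open>k \<le> n\<close>
        by (simp add: F_def smult_assoc1 smult_mult_left m_assoc)
    qed
    then show ?thesis
      by (simp add: box_eq f g finsum_ldistr finsum_smult_ldistr Pi_def cong: finsum_cong)
  qed
  then have "hurwitz_box S R \<alpha> t (hurwitz_box S R \<alpha> t f g) h n
      = (\<Oplus>\<^bsub>R\<^esub>k\<in>{..n}. \<Oplus>\<^bsub>R\<^esub>i\<in>{..k}. F n i (k - i))"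
    using hurwitz_box_closed[OF \<alpha> u f g]
    by (simp add: box_eq[OF _ h] Pi_def cong: finsum_cong)
  also have "\<dots> = (\<Oplus>\<^bsub>R\<^esub>i\<in>{..n}. \<Oplus>\<^bsub>R\<^esub>j\<in>{..n - i}. F n i j)"
    by (rule finsum_triangle) simp
  also have "\<dots> = hurwitz_box S R \<alpha> t f (hurwitz_box S R \<alpha> t g h) n"
  proof -
    have "?c i (n - i) \<odot>\<^bsub>R\<^esub> (f i \<otimes>\<^bsub>R\<^esub> (\<alpha> ^^ i) (hurwitz_box S R \<alpha> t g h (n - i)))
        = (\<Oplus>\<^bsub>R\<^esub>j\<in>{..n - i}. F n i j)" for i
    proof -
      \<comment> \<open>S-linearity of \<open>\<alpha> ^^ i\<close> lets the inner scalar out,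
        multiplicativity splits the product, and the two powers of \<open>\<alpha>\<close> on
        \<open>h\<close> compose to \<open>\<alpha> ^^ (i + j)\<close>.\<close>
      have "F n i j = ?c i (n - i) \<odot>\<^bsub>R\<^esub> (f i \<otimes>\<^bsub>R\<^esub> (\<alpha> ^^ i)
          (?c j (n - i - j) \<odot>\<^bsub>R\<^esub> (g j \<otimes>\<^bsub>R\<^esub> (\<alpha> ^^ j) (h (n - i - j)))))" for j
        using endo[of i]
        by (simp add: F_def smult_assoc1 smult_mult_right ring_hom_mult[OF hom] funpow_add
            algebra_endomorphism_def)
      then show ?thesis
        by (simp add: box_eq g h algebra_endomorphism_finsum[OF endo] finsum_rdistr
            finsum_smult_ldistr Pi_def cong: finsum_cong)
    qed
    then show ?thesis
      using hurwitz_box_closed[OF \<alpha> u g h]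
      by (simp add: box_eq[OF f] Pi_def cong: finsum_cong)
  qed
  finally show "hurwitz_box S R \<alpha> t (hurwitz_box S R \<alpha> t f g) h n
      = hurwitz_box S R \<alpha> t f (hurwitz_box S R \<alpha> t g h) n" .
qed

lemma h1_closed: "h1 R \<in> UNIV \<rightarrow> carrier R"
  by (simp add: h1_def)

text \<open>Only the term evaluating \<open>h1\<close> at 0 survives, with coefficient 1:
  \<open>k = 0\<close> on the left, where \<open>\<alpha> ^^ 0\<close> is the identity, and
  \<open>k = n\<close> on the right, since powers of \<open>\<alpha>\<close> fix 1 and 0.\<close>

lemma hurwitz_box_h1:
  assumes \<alpha>: "algebra_endomorphism S R \<alpha>" and u: "\<And>n. falling S t n \<in> Units S"
    and f: "f \<in> UNIV \<rightarrow> carrier R"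
  shows "hurwitz_box S R \<alpha> t (h1 R) f = f" "hurwitz_box S R \<alpha> t f (h1 R) = f"
proof -
  have fc [simp]: "f i \<in> carrier R" for i
    using f by auto
  have hom: "\<alpha> ^^ i \<in> ring_hom R R" for i
    using algebra_endomorphism_funpow[OF \<alpha>] by (simp add: algebra_endomorphism_def)
  note [simp] = algebra_endomorphism_funpow_closed[OF \<alpha>]
  have [simp]: "hurwitz_coeff S t i j \<in> carrier S" for i j
    by (rule R.hurwitz_coeff_closed[OF u])
  have [simp]: "(\<alpha> ^^ i) \<one>\<^bsub>R\<^esub> = \<one>\<^bsub>R\<^esub>" "(\<alpha> ^^ i) \<zero>\<^bsub>R\<^esub> = \<zero>\<^bsub>R\<^esub>" for i
    using ring_hom_one[OF hom] ring_hom_zero[OF hom ring_axioms ring_axioms] by auto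
  note simps = h1_def R.hurwitz_coeff_0[OF u]
  show "hurwitz_box S R \<alpha> t (h1 R) f = f"
  proof
    fix n
    \<comment> \<open>The test is written \<open>0 = k\<close> to fit the shape of
      \<open>finsum_singleton\<close>.\<close>
    have "hurwitz_box S R \<alpha> t (h1 R) f n = (\<Oplus>\<^bsub>R\<^esub>k\<in>{..n}. if 0 = k then f n else \<zero>\<^bsub>R\<^esub>)"
      unfolding hurwitz_box_eq[OF \<alpha> u h1_closed f]
      by (rule finsum_cong') (auto simp: simps)
    then show "hurwitz_box S R \<alpha> t (h1 R) f n = f n"
      using finsum_singleton[of 0 "{..n}" "\<lambda>_. f n"] by simp
  qed
  show "hurwitz_box S R \<alpha> t f (h1 R) = f"
  proof
    fix n
    have "hurwitz_box S R \<alpha> t f (h1 R) n = (\<Oplus>\<^bsub>R\<^esub>k\<in>{..n}. if n = k then f k else \<zero>\<^bsub>R\<^esub>)"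
      unfolding hurwitz_box_eq[OF \<alpha> u f h1_closed]
      by (rule finsum_cong') (auto simp: simps)
    then show "hurwitz_box S R \<alpha> t f (h1 R) n = f n"
      using finsum_singleton[of n "{..n}" f] by simp
  qed
qed

lemma hurwitz_box_minus_one:
  assumes \<alpha>: "algebra_endomorphism S R \<alpha>"
    and u: "\<And>n. falling S (\<ominus>\<^bsub>S\<^esub> \<one>\<^bsub>S\<^esub>) n \<in> Units S"
    and f: "f \<in> UNIV \<rightarrow> carrier R" and g: "g \<in> UNIV \<rightarrow> carrier R"
  shows "hurwitz_box S R \<alpha> (\<ominus>\<^bsub>S\<^esub> \<one>\<^bsub>S\<^esub>) f g = f \<otimes>\<^bsub>skew_hurwitz_ring R \<alpha>\<^esub> g"
proof
  fix n
  have fg: "f i \<in> carrier R" "g i \<in> carrier R" for i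
    using f g by auto
  have "(\<alpha> ^^ i) (g j) \<in> carrier R" for i j
    using fg by (simp add: algebra_endomorphism_funpow_closed[OF \<alpha>])
  with fg show "hurwitz_box S R \<alpha> (\<ominus>\<^bsub>S\<^esub> \<one>\<^bsub>S\<^esub>) f g n = (f \<otimes>\<^bsub>skew_hurwitz_ring R \<alpha>\<^esub> g) n"
    unfolding hurwitz_box_eq[OF \<alpha> u f g]
    \<comment> \<open>The sums agree termwise: for \<open>k \<le> n\<close> the upper entry
      \<open>k + (n - k)\<close> of the binomial coefficient is \<open>n\<close>.\<close>
    by (simp add: skew_hurwitz_ring_def R.hurwitz_coeff_minus_one[OF u] add_pow_smult_one Pi_def
        cong: finsum_cong)
qed

end

theorem proposition2p4:
  fixes S :: "('s, 'm) ring_scheme" and R :: "('s, 'r, 'k) module_scheme"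
    and \<alpha> :: "'r \<Rightarrow> 'r" and t :: 's
  assumes "assoc_algebra S R"
    and "algebra_endomorphism S R \<alpha>"
    and "t \<in> carrier S"
    and "\<And>n. falling S t n \<in> Units S"
  shows "(\<forall>f \<in> UNIV \<rightarrow> carrier R. \<forall>g \<in> UNIV \<rightarrow> carrier R.
            hurwitz_box S R \<alpha> t f g \<in> UNIV \<rightarrow> carrier R)
       \<and> (\<forall>f \<in> UNIV \<rightarrow> carrier R. \<forall>g \<in> UNIV \<rightarrow> carrier R. \<forall>h \<in> UNIV \<rightarrow> carrier R.
            hurwitz_box S R \<alpha> t (hurwitz_box S R \<alpha> t f g) h
            = hurwitz_box S R \<alpha> t f (hurwitz_box S R \<alpha> t g h))
       \<and> h1 R \<in> UNIV \<rightarrow> carrier R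
       \<and> (\<forall>f \<in> UNIV \<rightarrow> carrier R.
            hurwitz_box S R \<alpha> t (h1 R) f = f \<and> hurwitz_box S R \<alpha> t f (h1 R) = f)
       \<and> (t = \<ominus>\<^bsub>S\<^esub> \<one>\<^bsub>S\<^esub> \<longrightarrow>
            (\<forall>f \<in> UNIV \<rightarrow> carrier R. \<forall>g \<in> UNIV \<rightarrow> carrier R.
               hurwitz_box S R \<alpha> t f g = f \<otimes>\<^bsub>skew_hurwitz_ring R \<alpha>\<^esub> g))"
proof -
  interpret assoc_algebra S R by fact
  note h = assms(2,4)
  show ?thesis
    using hurwitz_box_closed[OF h] hurwitz_box_assoc[OF h] h1_closed hurwitz_box_h1[OF h]
      hurwitz_box_minus_one[OF assms(2)] assms(4)
    by auto
qed

end
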